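(* Let $\gamma\in(0,1)$, let $\alpha>\beta$ and $\tau>0$ be constants, and let $G_n\sim\mathrm{PDSM}(n,\mu_1,\mu_2,\tau^2)$ with $\mu_1=\alpha\sqrt{\frac{\log n}{n}}$, $\mu_2=\beta\sqrt{\frac{\log n}{n}}$ and planted labeling $\zeta^*\in\Theta_n^\gamma$. Let $\mathrm{SNR}=\frac{(\alpha-\beta)^2}{8\tau^2}$. If $\gamma\,\mathrm{SNR}<\frac34$, then the maximum likelihood estimator fails to recover $\zeta^*$ with high probability: $$\limsup_{n\to\infty}\mathbb{P}\big(M(\hat\zeta_{MLE},\zeta^* )=1\big)=0,\qquad\text{equivalently}\qquad\liminf_{n\to\infty}\mathbb{P}\big(M(\hat\zeta_{MLE},\zeta^* )\ne1\big)=1 .$$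
   Context: $[n]=\{1,\dots,n\}$; $n$ ranges over positive integers for which $\gamma n$ is an integer; $\Theta_n^\gamma=\{\zeta\in\{0,1\}^n:\sum_i\zeta_i=\gamma n\}$. Gaussian weighted planted dense subgraph model $\mathrm{PDSM}(n,\mu_1,\mu_2,\tau^2)$ (with parameter $\gamma$): given a planted (unobserved) labeling $\zeta^*\in\Theta_n^\gamma$, the observed symmetric weighted adjacency matrix $A=(A_{ij})_{i,j\in[n]}$ has $A_{ii}=0$, and, independently over unordered pairs $\{i,j\}$ with $i\neq j$, $A_{ij}=A_{ji}\sim N(\mu_1,\tau^2)$ if $\zeta_i^*=\zeta_j^*=1$ and $A_{ij}=A_{ji}\sim N(\mu_2,\tau^2)$ otherwise. Agreement ratio: $M(\hat\zeta,\zeta)=\frac1n\sum_{i=1}^n\mathbf 1_{\hat\zeta_i=\zeta_i}$ for $\hat\zeta,\zeta\in\{0,1\}^n$. The maximum likelihood estimator is $\hat\zeta_{MLE}\in\arg\max_{\zeta\in\Theta_n^\gamma}g_A(\zeta)$ with $g_A(\zeta)=\sum_{i,j}A_{ij}\zeta_i\zeta_j$. *)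

theory Defs
  imports "HOL-Probability.Probability"
begin

text \<open>
  Vertices are \<open>1, \<dots>, n\<close>; elements of $\{0,1\}^n$ are extensional functions on \<open>{1..n}\<close>, so that
  equality of labelings is equality on \<open>{1..n}\<close>.
\<close>

definition Theta :: "real \<Rightarrow> nat \<Rightarrow> (nat \<Rightarrow> nat) set" where
  "Theta \<gamma> n = {\<zeta> \<in> {1..n} \<rightarrow>\<^sub>E {0, 1}. real (\<Sum>i = 1..n. \<zeta> i) = \<gamma> * real n}"

definition sizes :: "real \<Rightarrow> nat set" where
  "sizes \<gamma> = {n. n > 0 \<and> \<gamma> * real n \<in> \<int>}"

text \<open>
  The limit \<open>n \<rightarrow> \<infinity>\<close> through the admissible sizes. This filter is trivial if \<open>sizes \<gamma>\<close> is finite,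
  which happens exactly when \<open>\<gamma>\<close> is irrational (and then \<open>sizes \<gamma>\<close> is empty).
\<close>

definition sizes_at_top :: "real \<Rightarrow> nat filter" where
  "sizes_at_top \<gamma> = inf sequentially (principal (sizes \<gamma>))"

text \<open>
  \<open>A\<close> is a random weighted adjacency matrix on the probability space \<open>M\<close>, with law
  \<open>PDSM(n, \<mu>\<^sub>1, \<mu>\<^sub>2, v)\<close> for the planted labeling \<open>\<zeta>\<close>. The parameter \<open>v\<close> is the variance, whereas
  \<^const>\<open>normal_density\<close> expects the standard deviation. Unordered pairs are represented by
  their members \<open>(i, j)\<close> with \<open>i < j\<close>.
\<close>

definition PDSM ::
  "real \<Rightarrow> nat \<Rightarrow> real \<Rightarrow> real \<Rightarrow> real \<Rightarrow> (nat \<Rightarrow> nat) \<Rightarrow> 'a measure \<Rightarrow> ('a \<Rightarrow> nat \<Rightarrow> nat \<Rightarrow> real) \<Rightarrow> bool"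
  where
  "PDSM \<gamma> n \<mu>\<^sub>1 \<mu>\<^sub>2 v \<zeta> M A \<longleftrightarrow>
     prob_space M \<and>
     \<zeta> \<in> Theta \<gamma> n \<and>
     (\<forall>\<omega>\<in>space M. \<forall>i\<in>{1..n}. A \<omega> i i = 0) \<and>
     (\<forall>\<omega>\<in>space M. \<forall>i\<in>{1..n}. \<forall>j\<in>{1..n}. A \<omega> i j = A \<omega> j i) \<and>
     prob_space.indep_vars M (\<lambda>_. borel) (\<lambda>(i, j) \<omega>. A \<omega> i j)
       {(i, j). 1 \<le> i \<and> i < j \<and> j \<le> n} \<and>
     (\<forall>i j. 1 \<le> i \<and> i < j \<and> j \<le> n \<longrightarrow>
       distributed M lborel (\<lambda>\<omega>. A \<omega> i j)
         (normal_density (if \<zeta> i = 1 \<and> \<zeta> j = 1 then \<mu>\<^sub>1 else \<mu>\<^sub>2) (sqrt v)))"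

definition agreement :: "nat \<Rightarrow> (nat \<Rightarrow> nat) \<Rightarrow> (nat \<Rightarrow> nat) \<Rightarrow> real" where
  "agreement n \<zeta>' \<zeta> = 1 / real n * (\<Sum>i = 1..n. if \<zeta>' i = \<zeta> i then 1 else 0)"

definition g :: "nat \<Rightarrow> (nat \<Rightarrow> nat \<Rightarrow> real) \<Rightarrow> (nat \<Rightarrow> nat) \<Rightarrow> real" where
  "g n a \<zeta> = (\<Sum>i = 1..n. \<Sum>j = 1..n. a i j * real (\<zeta> i) * real (\<zeta> j))"

text \<open>
  A maximum likelihood estimator is a random element of \<^term>\<open>Theta \<gamma> n\<close> (in particular
  measurable) that maximizes \<open>g\<close> over \<^term>\<open>Theta \<gamma> n\<close>; ties may be broken arbitrarily.
\<close>

definition is_MLE ::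
  "real \<Rightarrow> nat \<Rightarrow> 'a measure \<Rightarrow> ('a \<Rightarrow> nat \<Rightarrow> nat \<Rightarrow> real) \<Rightarrow> ('a \<Rightarrow> nat \<Rightarrow> nat) \<Rightarrow> bool" where
  "is_MLE \<gamma> n M A \<zeta>' \<longleftrightarrow>
     \<zeta>' \<in> measurable M (count_space (Theta \<gamma> n)) \<and>
     (\<forall>\<omega>\<in>space M. is_arg_max (g n (A \<omega>)) (\<lambda>\<zeta>. \<zeta> \<in> Theta \<gamma> n) (\<zeta>' \<omega>))"

definition SNR :: "real \<Rightarrow> real \<Rightarrow> real \<Rightarrow> real" where
  "SNR \<alpha> \<beta> \<tau> = (\<alpha> - \<beta>)\<^sup>2 / (8 * \<tau>\<^sup>2)"

end

theory Submission
  imports Defs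
    "HOL-Real_Asymp.Real_Asymp"
begin

text \<open>
  Exact recovery fails because some swap improves the objective. Let \<open>C\<close> be the planted vertex
  set, of size \<open>\<gamma> n\<close>. Replacing \<open>i \<in> C\<close> by \<open>j \<notin> C\<close> changes \<open>g\<close> by twice the difference
  between the weight that \<open>j\<close> and the weight that \<open>i\<close> sends to \<open>C - {i}\<close> (\<open>swap_gain\<close>). In
  expectation this difference is about \<open>- \<gamma> (\<alpha> - \<beta>) sqrt (n log n)\<close>. The weights are
  Gaussian with standard deviation about \<open>\<tau> sqrt (\<gamma> n)\<close>, and there are linearly many candidates
  for \<open>j\<close> and for \<open>i\<close>, so the best of either kind deviates from its mean in the favourable
  direction by about \<open>\<tau> sqrt (\<gamma> n) sqrt (2 log n)\<close>. Together they beat the drift as soon as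
  \<open>\<gamma> (\<alpha> - \<beta>) < 2 \<tau> sqrt (2 \<gamma>)\<close>, that is, \<open>\<gamma> SNR < 1\<close>, which follows from
  \<open>\<gamma> SNR < 3/4\<close>.

  The weights that two vertices of \<open>C\<close> send to \<open>C\<close> share an edge and are thus dependent. To
  avoid this, a set \<open>H \<subseteq> C\<close> of size \<open>\<eta> n\<close> is set apart, \<open>i\<close> is only taken from \<open>H\<close>, and the
  favourable deviations are only sought among the weights into \<open>D = C - H\<close>. The edges between a
  vertex outside \<open>D\<close> and \<open>D\<close> form a star, and stars of different vertices are disjoint. Hence
  these weights are independent, and one of them exceeds \<open>a sqrt (2 log n)\<close> standard
  deviations, \<open>a < 1\<close>, with probability tending to \<open>1\<close>. The remaining weights into \<open>H - {i}\<close>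
  are controlled by a union bound over the at most \<open>n\<^sup>2\<close> pairs \<open>(i, j)\<close>: none deviates
  unfavourably by more than \<open>\<tau> sqrt (\<eta> n) sqrt (6 log n)\<close>, which is negligible for small
  \<open>\<eta>\<close>. The lemma \<open>prob_exact_recovery_le\<close> is this argument for a fixed \<open>n\<close>;
  \<open>margin_choice\<close> picks \<open>a\<close> and \<open>\<eta>\<close>, and \<open>many_tails_limit\<close> shows that the resulting
  bound vanishes.
\<close>

section \<open>Gaussian tails and their maxima\<close>

text \<open>
  For \<open>t < x\<close> with \<open>0 \<le> t\<close>, the density at \<open>x\<close> is at most \<open>exp (- t\<^sup>2 / 2)\<close> times the
  density at \<open>x - t\<close>, and the shifted density integrates to \<open>1\<close>.
\<close>

lemma (in prob_space) std_normal_tail_upper: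
  assumes Z: "distributed M lborel Z std_normal_density" and t: "0 \<le> t"
  shows "prob {\<omega> \<in> space M. t < Z \<omega>} \<le> exp (- t\<^sup>2 / 2)"
proof -
  have shift: "(\<integral>\<^sup>+x. ennreal (std_normal_density (x - t)) \<partial>lborel) = 1"
  proof -
    have "(\<integral>\<^sup>+x. ennreal (std_normal_density (x - t)) \<partial>lborel)
        = (\<integral>\<^sup>+x. ennreal (normal_density t 1 x) \<partial>lborel)"
      by (simp add: normal_density_def)
    also have "\<dots> = emeasure (density lborel (normal_density t 1)) (space lborel)"
      by (subst emeasure_density) auto
    also have "\<dots> = 1"
      using prob_space.emeasure_space_1[OF prob_space_normal_density[of 1 t]] by simp
    finally show ?thesis .
  qed
  have "emeasure M {\<omega> \<in> space M. t < Z \<omega>} = emeasure M (Z -` {t<..} \<inter> space M)"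
    by (rule arg_cong[where f = "emeasure M"]) auto
  also have "\<dots> = (\<integral>\<^sup>+x. ennreal (std_normal_density x) * indicator {t<..} x \<partial>lborel)"
    by (rule distributed_emeasure[OF Z]) auto
  also have "\<dots> \<le> (\<integral>\<^sup>+x. ennreal (exp (- t\<^sup>2 / 2)) * ennreal (std_normal_density (x - t)) \<partial>lborel)"
  proof (rule nn_integral_mono)
    fix x :: real
    have "std_normal_density x \<le> exp (- t\<^sup>2 / 2) * std_normal_density (x - t)" if "t < x"
    proof -
      have "t * t \<le> t * x" using that t by (intro mult_left_mono) auto
      then have "- x\<^sup>2 / 2 \<le> - t\<^sup>2 / 2 + - (x - t)\<^sup>2 / 2"
        by (simp add: power2_eq_square field_simps)
      then have "exp (- x\<^sup>2 / 2) \<le> exp (- t\<^sup>2 / 2) * exp (- (x - t)\<^sup>2 / 2)"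
        unfolding exp_add[symmetric] by simp
      then show ?thesis unfolding std_normal_density_def by (simp add: field_simps)
    qed
    then show "ennreal (std_normal_density x) * indicator {t<..} x
        \<le> ennreal (exp (- t\<^sup>2 / 2)) * ennreal (std_normal_density (x - t))"
      by (auto simp: indicator_def ennreal_mult'[symmetric] intro!: ennreal_leI)
  qed
  also have "\<dots> = ennreal (exp (- t\<^sup>2 / 2))"
    by (subst nn_integral_cmult) (auto simp: shift)
  finally show ?thesis
    by (simp add: emeasure_eq_measure)
qed

text \<open>
  The density is at least its value at \<open>t + 1\<close> on the unit interval to the right of \<open>t\<close>. This loses
  only a factor \<open>exp (O(t))\<close>, which does not affect the leading order of the maximum of many
  independent variables.
\<close>

lemma (in prob_space) std_normal_tail_lower:
  assumes Z: "distributed M lborel Z std_normal_density" and t: "0 \<le> t"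
  shows "std_normal_density (t + 1) \<le> prob {\<omega> \<in> space M. t < Z \<omega>}"
proof -
  have "ennreal (std_normal_density (t + 1))
      = (\<integral>\<^sup>+x. ennreal (std_normal_density (t + 1)) * indicator {t<..t + 1} x \<partial>lborel)"
    by (subst nn_integral_cmult_indicator) auto
  also have "\<dots> \<le> (\<integral>\<^sup>+x. ennreal (std_normal_density x) * indicator {t<..} x \<partial>lborel)"
  proof (rule nn_integral_mono)
    fix x :: real
    have "std_normal_density (t + 1) \<le> std_normal_density x" if "t < x" "x \<le> t + 1"
    proof -
      have "x\<^sup>2 \<le> (t + 1)\<^sup>2" using that t by (intro power_mono) auto
      then show ?thesis unfolding std_normal_density_def by (intro mult_left_mono) auto
    qed
    then show "ennreal (std_normal_density (t + 1)) * indicator {t<..t + 1} x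
        \<le> ennreal (std_normal_density x) * indicator {t<..} x"
      by (auto simp: indicator_def intro!: ennreal_leI)
  qed
  also have "\<dots> = emeasure M (Z -` {t<..} \<inter> space M)"
    by (rule distributed_emeasure[OF Z, symmetric]) auto
  also have "\<dots> = emeasure M {\<omega> \<in> space M. t < Z \<omega>}"
    by (rule arg_cong[where f = "emeasure M"]) auto
  finally show ?thesis
    by (simp add: emeasure_eq_measure)
qed

text \<open>
  The standardized sum of the independent Gaussians \<open>X e\<close>, \<open>e \<in> E\<close>, with means \<open>m e\<close> and common
  standard deviation \<open>\<tau>\<close>. The sign \<open>s\<close> is \<open>1\<close> or \<open>-1\<close>, so that upper and lower deviations
  are treated alike.
\<close>

definition zscore ::
  "real \<Rightarrow> ('e \<Rightarrow> real) \<Rightarrow> real \<Rightarrow> ('e \<Rightarrow> 'a \<Rightarrow> real) \<Rightarrow> 'e set \<Rightarrow> 'a \<Rightarrow> real" where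
  "zscore s m \<tau> X E \<omega> = s * ((\<Sum>e\<in>E. X e \<omega>) - (\<Sum>e\<in>E. m e)) / (\<tau> * sqrt (real (card E)))"

lemma (in prob_space) distributed_zscore:
  assumes indep: "indep_vars (\<lambda>_. borel) X I"
    and normal: "\<And>e. e \<in> I \<Longrightarrow> distributed M lborel (X e) (normal_density (m e) \<tau>)"
    and \<tau>: "0 < \<tau>" and s: "\<bar>s\<bar> = 1"
    and E: "E \<subseteq> I" "finite E" "E \<noteq> {}"
  shows "distributed M lborel (zscore s m \<tau> X E) std_normal_density"
proof -
  define \<sigma> where "\<sigma> = \<tau> * sqrt (real (card E))"
  have \<sigma>: "0 < \<sigma>" using \<tau> E by (simp add: \<sigma>_def card_gt_0_iff)
  have "distributed M lborel (\<lambda>\<omega>. \<Sum>e\<in>E. X e \<omega>)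
      (normal_density (\<Sum>e\<in>E. m e) (sqrt (\<Sum>e\<in>E. \<tau>\<^sup>2)))"
    using E \<tau> by (intro sum_indep_normal indep_vars_subset[OF indep] normal) auto
  also have "sqrt (\<Sum>e\<in>E. \<tau>\<^sup>2) = \<sigma>"
    using \<tau> by (simp add: \<sigma>_def real_sqrt_mult)
  finally have "distributed M lborel
      (\<lambda>\<omega>. - (s / \<sigma>) * (\<Sum>e\<in>E. m e) + (s / \<sigma>) * (\<Sum>e\<in>E. X e \<omega>))
      (normal_density (- (s / \<sigma>) * (\<Sum>e\<in>E. m e) + (s / \<sigma>) * (\<Sum>e\<in>E. m e)) (\<bar>s / \<sigma>\<bar> * \<sigma>))"
    using \<sigma> s by (intro normal_density_affine) auto
  moreover have "(\<lambda>\<omega>. - (s / \<sigma>) * (\<Sum>e\<in>E. m e) + (s / \<sigma>) * (\<Sum>e\<in>E. X e \<omega>)) = zscore s m \<tau> X E"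
    by (auto simp: zscore_def \<sigma>_def[symmetric] algebra_simps diff_divide_distrib)
  moreover have "\<bar>s / \<sigma>\<bar> * \<sigma> = 1" using \<sigma> s by (simp add: abs_divide)
  moreover have "- (s / \<sigma>) * (\<Sum>e\<in>E. m e) + (s / \<sigma>) * (\<Sum>e\<in>E. m e) = 0" by simp
  ultimately show ?thesis by (simp only:)
qed

text \<open>
  Sums over disjoint blocks are independent, and each stays below \<open>t\<close> with probability at most
  \<open>1 - p \<le> exp (- p)\<close>, where \<open>p\<close> is the lower bound for the tail beyond \<open>t\<close>.
\<close>

lemma (in prob_space) prob_all_zscores_le:
  assumes indep: "indep_vars (\<lambda>_. borel) X I"
    and normal: "\<And>e. e \<in> I \<Longrightarrow> distributed M lborel (X e) (normal_density (m e) \<tau>)"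
    and \<tau>: "0 < \<tau>" and s: "\<bar>s\<bar> = 1"
    and E: "\<And>l. l \<in> L \<Longrightarrow> E l \<subseteq> I \<and> finite (E l) \<and> E l \<noteq> {}"
    and disj: "disjoint_family_on E L" and L: "finite L" and t: "0 \<le> t"
  shows "prob {\<omega> \<in> space M. \<forall>l\<in>L. zscore s m \<tau> X (E l) \<omega> \<le> t}
      \<le> exp (- (real (card L) * std_normal_density (t + 1)))"
proof (cases "L = {}")
  case True then show ?thesis by simp
next
  case False
  let ?Z = "\<lambda>l. zscore s m \<tau> X (E l)"
  have Z: "distributed M lborel (?Z l) std_normal_density" if "l \<in> L" for l
    using E[OF that] by (intro distributed_zscore[OF indep normal \<tau> s]) auto
  \<comment> \<open>the block sum has to be a function of the restriction of \<open>X\<close> to the block\<close>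
  have "indep_vars (\<lambda>_. borel)
      (\<lambda>l \<omega>. s * ((\<Sum>e\<in>E l. (restrict (\<lambda>e. X e \<omega>) (E l)) e) - (\<Sum>e\<in>E l. m e)) / (\<tau> * sqrt (real (card (E l))))) L"
    by (rule indep_vars_compose2[OF indep_vars_restrict[OF indep _ disj]]) (use E in auto)
  then have indZ: "indep_vars (\<lambda>_. borel) ?Z L"
    by (subst indep_vars_cong) (auto simp: zscore_def[abs_def])
  have le: "prob (?Z l -` {..t} \<inter> space M) \<le> exp (- std_normal_density (t + 1))" if "l \<in> L" for l
  proof -
    have [measurable]: "?Z l \<in> borel_measurable M"
      using Z[OF that] by (simp add: distributed_def)
    have "?Z l -` {..t} \<inter> space M = space M - {\<omega> \<in> space M. t < ?Z l \<omega>}" by auto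
    then have "prob (?Z l -` {..t} \<inter> space M) = 1 - prob {\<omega> \<in> space M. t < ?Z l \<omega>}"
      by (simp only:) (rule prob_compl, measurable)
    also have "\<dots> \<le> 1 + - std_normal_density (t + 1)"
      using std_normal_tail_lower[OF Z[OF that] t] by simp
    also have "\<dots> \<le> exp (- std_normal_density (t + 1))" by (rule exp_ge_add_one_self)
    finally show ?thesis .
  qed
  have "{\<omega> \<in> space M. \<forall>l\<in>L. ?Z l \<omega> \<le> t} = (\<Inter>l\<in>L. ?Z l -` {..t} \<inter> space M)"
    using False by auto
  then have "prob {\<omega> \<in> space M. \<forall>l\<in>L. ?Z l \<omega> \<le> t} = (\<Prod>l\<in>L. prob (?Z l -` {..t} \<inter> space M))"
    using indep_varsD_finite[OF indZ False L, of "\<lambda>_. {..t}"] by simp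
  also have "\<dots> \<le> (\<Prod>l\<in>L. exp (- std_normal_density (t + 1)))"
    using le by (intro prod_mono) auto
  also have "\<dots> = exp (- (real (card L) * std_normal_density (t + 1)))"
    by (simp add: exp_of_nat_mult[symmetric])
  finally show ?thesis .
qed

section \<open>Asymptotics\<close>

text \<open>
  With \<open>y = sqrt (2 ln n)\<close>, the product of \<open>n = exp (y\<^sup>2 / 2)\<close> and the density at \<open>a y + 1\<close> is
  \<open>exp ((1 - a\<^sup>2) y\<^sup>2 / 2 - a y - 1 / 2)\<close> up to a constant, which tends to infinity since
  \<open>a < 1\<close>.
\<close>

lemma many_tails_limit:
  fixes a c :: real
  assumes "0 < a" "a < 1" "0 < c"
  shows "(\<lambda>n::nat. exp (- (c * real n * std_normal_density (a * sqrt (2 * ln (real n)) + 1)))) \<longlonglongrightarrow> 0"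
proof -
  have "a * a < 1 * 1" using assms by (intro mult_strict_mono) auto
  then have "0 < 1 - a\<^sup>2" by (simp add: power2_eq_square)
  define b where "b = 1 - a\<^sup>2"
  have b: "0 < b" using \<open>0 < 1 - a\<^sup>2\<close> by (simp add: b_def)
  have "filterlim (\<lambda>y::real. c / sqrt (2 * pi) * exp (b * y\<^sup>2 / 2 - a * y - 1 / 2)) at_top at_top"
    using b assms by real_asymp
  moreover have "filterlim (\<lambda>n::nat. sqrt (2 * ln (real n))) at_top at_top"
    by real_asymp
  ultimately have "filterlim (\<lambda>n::nat. c / sqrt (2 * pi) *
      exp (b * (sqrt (2 * ln (real n)))\<^sup>2 / 2 - a * sqrt (2 * ln (real n)) - 1 / 2)) at_top at_top"
    by (rule filterlim_compose)
  moreover have "\<forall>\<^sub>F n::nat in at_top. c / sqrt (2 * pi) *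
        exp (b * (sqrt (2 * ln (real n)))\<^sup>2 / 2 - a * sqrt (2 * ln (real n)) - 1 / 2)
      = c * real n * std_normal_density (a * sqrt (2 * ln (real n)) + 1)"
    using eventually_gt_at_top[of "0::nat"]
  proof eventually_elim
    case (elim n)
    define y where "y = sqrt (2 * ln (real n))"
    have y: "y\<^sup>2 / 2 = ln (real n)" using elim by (simp add: y_def)
    have "exp (b * y\<^sup>2 / 2 - a * y - 1 / 2) = exp (y\<^sup>2 / 2 + - (a * y + 1)\<^sup>2 / 2)"
      by (simp add: b_def power2_eq_square field_simps)
    also have "\<dots> = real n * exp (- (a * y + 1)\<^sup>2 / 2)"
      unfolding exp_add y using elim by simp
    finally show ?case by (simp add: std_normal_density_def y_def[symmetric])
  qed
  ultimately have "filterlim (\<lambda>n::nat. c * real n *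
      std_normal_density (a * sqrt (2 * ln (real n)) + 1)) at_top at_top"
    by (rule filterlim_cong[OF refl refl, THEN iffD1, rotated])
  then show ?thesis
    by (intro filterlim_compose[OF exp_at_bot] filterlim_compose[OF filterlim_uminus_at_bot_at_top]) 
qed

text \<open>
  In the limit \<open>a \<rightarrow> 1\<close>, \<open>\<eta> \<rightarrow> 0\<close> the inequality between drift and fluctuations becomes
  \<open>\<gamma> d < 2 \<tau> sqrt (2 \<gamma>)\<close>, which is the hypothesis on the signal-to-noise ratio after
  squaring; by continuity it persists along \<open>a = 1 - x\<close>, \<open>\<eta> = x\<close> for small \<open>x > 0\<close>.
\<close>

lemma margin_choice:
  fixes \<gamma> d \<tau> :: real
  assumes \<gamma>: "0 < \<gamma>" "\<gamma> < 1" and d: "0 < d" and \<tau>: "0 < \<tau>" and snr: "\<gamma> * (d\<^sup>2 / (8 * \<tau>\<^sup>2)) < 1"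
  obtains a \<eta> where "0 < a" "a < 1" "0 < \<eta>" "\<eta> < \<gamma>" 
    "\<gamma> * d \<le> 2 * \<tau> * (a * sqrt 2 * sqrt (\<gamma> - \<eta>)) - 2 * \<tau> * (sqrt 6 * sqrt \<eta>)"
proof -
  have "(\<gamma> * d)\<^sup>2 < (2 * \<tau> * (sqrt 2 * sqrt \<gamma>))\<^sup>2"
  proof -
    have "\<gamma> * d\<^sup>2 < 8 * \<tau>\<^sup>2" using snr \<tau> by (simp add: field_simps)
    then have "\<gamma> * (\<gamma> * d\<^sup>2) < \<gamma> * (8 * \<tau>\<^sup>2)" using \<gamma> by (intro mult_strict_left_mono)
    then show ?thesis using \<gamma> by (simp add: power_mult_distrib power2_eq_square[of \<gamma>] mult_ac)
  qed
  then have 0: "\<gamma> * d < 2 * \<tau> * (sqrt 2 * sqrt \<gamma>)"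
    by (rule power2_less_imp_less) (use \<gamma> \<tau> in auto)
  have "((\<lambda>x. 2 * \<tau> * ((1 - x) * sqrt 2 * sqrt (\<gamma> - x)) - 2 * \<tau> * (sqrt 6 * sqrt x)) \<longlongrightarrow>
      2 * \<tau> * ((1 - 0) * sqrt 2 * sqrt (\<gamma> - 0)) - 2 * \<tau> * (sqrt 6 * sqrt 0)) (at_right 0)"
    by (intro tendsto_intros)
  then have "\<forall>\<^sub>F x in at_right 0. \<gamma> * d < 2 * \<tau> * ((1 - x) * sqrt 2 * sqrt (\<gamma> - x)) - 2 * \<tau> * (sqrt 6 * sqrt x)"
    by (rule order_tendstoD) (use 0 in simp)
  moreover have "\<forall>\<^sub>F x in at_right 0. 0 < x \<and> x < \<gamma>"
    using \<gamma> by (auto simp: eventually_at_right)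
  ultimately have "\<forall>\<^sub>F x in at_right 0. 0 < x \<and> x < \<gamma> \<and>
      \<gamma> * d < 2 * \<tau> * ((1 - x) * sqrt 2 * sqrt (\<gamma> - x)) - 2 * \<tau> * (sqrt 6 * sqrt x)"
    by eventually_elim auto
  then obtain x where "0 < x" "x < \<gamma>"
      "\<gamma> * d < 2 * \<tau> * ((1 - x) * sqrt 2 * sqrt (\<gamma> - x)) - 2 * \<tau> * (sqrt 6 * sqrt x)"
    by (rule eventually_happens'[OF trivial_limit_at_right_real, THEN exE]) auto
  then show ?thesis using \<gamma> by (intro that[of "1 - x" x]) auto
qed

section \<open>Stars of edges\<close>

text \<open>
  The edges from \<open>i\<close> to the vertices in \<open>S\<close>, each in its increasing representation, since the
  independent edge weights are indexed by pairs \<open>(k, l)\<close> with \<open>k < l\<close>.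
\<close>

definition star :: "nat \<Rightarrow> nat set \<Rightarrow> (nat \<times> nat) set" where
  "star i S = (\<lambda>k. (min i k, max i k)) ` S"

lemma inj_on_star: "inj_on (\<lambda>k. (min i k, max i k)) S" for i :: nat
  by (rule inj_onI) (auto simp: min_def max_def split: if_splits)

lemma sum_star: "(\<Sum>e\<in>star i S. f e) = (\<Sum>k\<in>S. f (min i k, max i k))"
  unfolding star_def by (simp add: sum.reindex[OF inj_on_star])

lemma card_star: "card (star i S) = card S"
  unfolding star_def by (rule card_image[OF inj_on_star])

text \<open>
  An edge common to the stars of \<open>i \<noteq> i'\<close> would be \<open>{i, i'}\<close>, which puts a centre into \<open>S\<close>.
\<close>

lemma disjoint_family_star:
  assumes "L \<inter> S = {}"
  shows "disjoint_family_on (\<lambda>i. star i S) L"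
  using assms by (auto simp: disjoint_family_on_def star_def min_def max_def split: if_splits)

lemma star_subset_pairs:
  assumes "i \<in> {1..n}" "S \<subseteq> {1..n} - {i}"
  shows "star i S \<subseteq> {(i, j). 1 \<le> i \<and> i < j \<and> j \<le> n}"
proof
  fix e assume "e \<in> star i S"
  then obtain k where "k \<in> S" "e = (min i k, max i k)" by (auto simp: star_def)
  with assms show "e \<in> {(i, j). 1 \<le> i \<and> i < j \<and> j \<le> n}"
    by (auto simp: min_def max_def)
qed

section \<open>Swapping two vertices\<close>

lemma g_eq_sum_support:
  assumes "\<zeta> \<in> {1..n} \<rightarrow>\<^sub>E {0, 1}"
  shows "g n a \<zeta> = (\<Sum>k\<in>{k\<in>{1..n}. \<zeta> k = 1}. \<Sum>l\<in>{l\<in>{1..n}. \<zeta> l = 1}. a k l)"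
proof -
  have *: "real (\<zeta> k) = (if \<zeta> k = 1 then 1 else 0)" if "k \<in> {1..n}" for k
    using PiE_mem[OF assms that] by auto
  have "g n a \<zeta> = (\<Sum>k = 1..n. \<Sum>l = 1..n. if \<zeta> k = 1 then if \<zeta> l = 1 then a k l else 0 else 0)"
    unfolding g_def by (intro sum.cong refl) (simp add: *)
  also have "\<dots> = (\<Sum>k = 1..n. if \<zeta> k = 1 then \<Sum>l\<in>{l\<in>{1..n}. \<zeta> l = 1}. a k l else 0)"
    by (intro sum.cong refl) (simp add: sum.inter_filter[symmetric])
  finally show ?thesis by (simp add: sum.inter_filter[symmetric])
qed

lemma sum_sum_insert_symmetric:
  fixes a :: "nat \<Rightarrow> nat \<Rightarrow> real"
  assumes "finite B" "x \<notin> B" "a x x = 0" "\<And>k. k \<in> B \<Longrightarrow> a k x = a x k"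
  shows "(\<Sum>k\<in>insert x B. \<Sum>l\<in>insert x B. a k l) = (\<Sum>k\<in>B. \<Sum>l\<in>B. a k l) + 2 * (\<Sum>k\<in>B. a x k)"
proof -
  have "(\<Sum>k\<in>B. a k x) = (\<Sum>k\<in>B. a x k)" using assms by (intro sum.cong) auto
  then show ?thesis using assms by (simp add: sum.distrib)
qed

lemma swap_in_PiE:
  fixes \<zeta> :: "nat \<Rightarrow> nat"
  assumes \<zeta>: "\<zeta> \<in> {1..n} \<rightarrow>\<^sub>E {0, 1}" and "i \<in> {1..n}" "j \<in> {1..n}"
  shows "\<zeta>(i := 0, j := 1) \<in> {1..n} \<rightarrow>\<^sub>E {0, 1}"
proof (rule PiE_I)
  show "(\<zeta>(i := 0, j := 1)) k \<in> {0, 1}" if "k \<in> {1..n}" for k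
    using PiE_mem[OF \<zeta> that] by simp
  show "(\<zeta>(i := 0, j := 1)) k = undefined" if "k \<notin> {1..n}" for k
    using PiE_arb[OF \<zeta> that] that assms by auto
qed

text \<open>
  Both vertex sets arise by adding one vertex to \<open>{k. \<zeta> k = 1} - {i}\<close>, whose internal weight
  cancels. The factor \<open>2\<close> appears because \<open>g\<close> counts each edge in both directions.
\<close>

lemma swap_gain:
  assumes \<zeta>: "\<zeta> \<in> {1..n} \<rightarrow>\<^sub>E {0, 1}" and i: "i \<in> {1..n}" "\<zeta> i = 1" and j: "j \<in> {1..n}" "\<zeta> j \<noteq> 1"
    and diag: "\<forall>k\<in>{1..n}. a k k = 0"
    and sym: "\<forall>k\<in>{1..n}. \<forall>l\<in>{1..n}. a k l = a l k"
  shows "g n a (\<zeta>(i := 0, j := 1)) - g n a \<zeta>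
      = 2 * ((\<Sum>k\<in>{k\<in>{1..n}. \<zeta> k = 1} - {i}. a j k) - (\<Sum>k\<in>{k\<in>{1..n}. \<zeta> k = 1} - {i}. a i k))"
proof -
  let ?B = "{k\<in>{1..n}. \<zeta> k = 1} - {i}"
  have \<zeta>': "\<zeta>(i := 0, j := 1) \<in> {1..n} \<rightarrow>\<^sub>E {0, 1}"
    by (rule swap_in_PiE[OF \<zeta> i(1) j(1)])
  have 1: "{k\<in>{1..n}. \<zeta> k = 1} = insert i ?B"
    and 2: "{k\<in>{1..n}. (\<zeta>(i := 0, j := 1)) k = 1} = insert j ?B"
    using i j by auto
  have sums: "(\<Sum>k\<in>insert x ?B. \<Sum>l\<in>insert x ?B. a k l)
      = (\<Sum>k\<in>?B. \<Sum>l\<in>?B. a k l) + 2 * (\<Sum>k\<in>?B. a x k)" if "x \<in> {i, j}" for x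
    by (rule sum_sum_insert_symmetric) (use that i j diag sym in auto)
  have "g n a \<zeta> = (\<Sum>k\<in>?B. \<Sum>l\<in>?B. a k l) + 2 * (\<Sum>k\<in>?B. a i k)"
    using sums[of i] unfolding g_eq_sum_support[OF \<zeta>] 1[symmetric] by (simp only: insertI1)
  moreover have "g n a (\<zeta>(i := 0, j := 1)) = (\<Sum>k\<in>?B. \<Sum>l\<in>?B. a k l) + 2 * (\<Sum>k\<in>?B. a j k)"
    using sums[of j] unfolding g_eq_sum_support[OF \<zeta>'] 2 by (simp only: insertI1 insertI2)
  ultimately show ?thesis by (simp only: right_diff_distrib)
qed

lemma swap_in_Theta:
  assumes "\<zeta> \<in> Theta \<gamma> n" and i: "i \<in> {1..n}" "\<zeta> i = 1" and j: "j \<in> {1..n}" "\<zeta> j \<noteq> 1"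
  shows "\<zeta>(i := 0, j := 1) \<in> Theta \<gamma> n"
proof -
  have \<zeta>: "\<zeta> \<in> {1..n} \<rightarrow>\<^sub>E {0, 1}" using assms by (simp add: Theta_def)
  have "\<zeta> j = 0" "i \<noteq> j" using PiE_mem[OF \<zeta> j(1)] i j by auto
  have split: "(\<Sum>k = 1..n. f k) = f i + f j + (\<Sum>k\<in>{1..n} - {i} - {j}. f k)" for f :: "nat \<Rightarrow> nat"
    using i j \<open>i \<noteq> j\<close>
    using sum.remove[of "{1..n}" i f] sum.remove[of "{1..n} - {i}" j f] by simp
  have "(\<Sum>k = 1..n. (\<zeta>(i := 0, j := 1)) k) = (\<Sum>k = 1..n. \<zeta> k)"
    unfolding split using \<open>\<zeta> j = 0\<close> \<open>i \<noteq> j\<close> i by (auto intro!: sum.cong)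
  moreover have "\<zeta>(i := 0, j := 1) \<in> {1..n} \<rightarrow>\<^sub>E {0, 1}"
    by (rule swap_in_PiE[OF \<zeta> i(1) j(1)])
  ultimately show ?thesis using assms(1) by (simp add: Theta_def del: fun_upd_apply of_nat_sum)
qed

lemma card_support_Theta:
  assumes "\<zeta> \<in> Theta \<gamma> n"
  shows "real (card {k\<in>{1..n}. \<zeta> k = 1}) = \<gamma> * real n"
proof -
  have \<zeta>: "\<zeta> \<in> {1..n} \<rightarrow>\<^sub>E {0, 1}" using assms by (simp add: Theta_def)
  have "(\<Sum>k = 1..n. \<zeta> k) = (\<Sum>k = 1..n. if \<zeta> k = 1 then 1 else 0)"
    using PiE_mem[OF \<zeta>] by (intro sum.cong) auto
  also have "\<dots> = card {k\<in>{1..n}. \<zeta> k = 1}" by (simp add: sum.inter_filter[symmetric])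
  finally show ?thesis using assms unfolding Theta_def by (simp del: of_nat_sum)
qed

lemma agreement_eq_1_iff:
  assumes "0 < n" "\<zeta>' \<in> Theta \<gamma> n" "\<zeta> \<in> Theta \<gamma> n"
  shows "agreement n \<zeta>' \<zeta> = 1 \<longleftrightarrow> \<zeta>' = \<zeta>"
proof
  assume "agreement n \<zeta>' \<zeta> = 1"
  then have "(\<Sum>k = 1..n. if \<zeta>' k = \<zeta> k then 1 else 0 :: real) = real n"
    using assms(1) by (simp add: agreement_def)
  then have "real (card {k\<in>{1..n}. \<zeta>' k = \<zeta> k}) = real n"
    by (simp add: sum.inter_filter[symmetric])
  then have "{k\<in>{1..n}. \<zeta>' k = \<zeta> k} = {1..n}"
    by (intro card_subset_eq) auto
  then have "\<zeta>' k = \<zeta> k" if "k \<in> {1..n}" for k using that by blast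
  moreover have "\<zeta>' \<in> {1..n} \<rightarrow>\<^sub>E {0, 1}" "\<zeta> \<in> {1..n} \<rightarrow>\<^sub>E {0, 1}"
    using assms(2,3) by (simp_all add: Theta_def)
  ultimately show "\<zeta>' = \<zeta>" by (metis PiE_ext)
next
  assume "\<zeta>' = \<zeta>" then show "agreement n \<zeta>' \<zeta> = 1"
    using assms(1) by (simp add: agreement_def)
qed

section \<open>Probability of exact recovery\<close>

text \<open>
  If the planted labeling is a maximizer, then no swap of \<open>i \<in> H\<close> and \<open>j \<notin> C\<close> gains. This
  forces one of three events: no \<open>j \<notin> C\<close> sends more than \<open>t\<close> standard deviations above the mean
  into \<open>D\<close>; no \<open>i \<in> H\<close> sends less than \<open>t\<close> standard deviations below the mean into \<open>D\<close>; or,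
  for some pair, a weight into \<open>H - {i}\<close> is more than \<open>u\<close> standard deviations off in the
  direction that makes the swap worse. The margin condition says precisely that two favourable
  deviations \<open>t\<close> outweigh the drift and two unfavourable deviations \<open>u\<close>. The requirement
  \<open>2 \<le> h\<close> keeps \<open>H - {i}\<close> nonempty, so that the sum over it is a nondegenerate Gaussian.
\<close>

lemma prob_exact_recovery_le:
  fixes M :: "'a measure"
  assumes pdsm: "PDSM \<gamma> n \<mu>\<^sub>1 \<mu>\<^sub>2 (\<tau>\<^sup>2) \<zeta> M A" and mle: "is_MLE \<gamma> n M A \<zeta>'" and \<tau>: "0 < \<tau>"
  defines "C \<equiv> {k\<in>{1..n}. \<zeta> k = 1}"
  assumes h: "2 \<le> h" "h < card C" and t: "0 \<le> t" and u: "0 \<le> u"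
    and margin: "(real (card C) - 1) * (\<mu>\<^sub>1 - \<mu>\<^sub>2)
        \<le> 2 * \<tau> * (t * sqrt (real (card C) - real h)) - 2 * \<tau> * (u * sqrt (real h - 1))"
  shows "measure M {\<omega> \<in> space M. \<zeta>' \<omega> = \<zeta>}
      \<le> exp (- ((real n - real (card C)) * std_normal_density (t + 1)))
        + exp (- (real h * std_normal_density (t + 1))) + 2 * (real n)\<^sup>2 * exp (- u\<^sup>2 / 2)"
proof -
  interpret prob_space M using pdsm by (simp add: PDSM_def)
  have \<zeta>: "\<zeta> \<in> Theta \<gamma> n" and diag: "\<And>\<omega>. \<omega> \<in> space M \<Longrightarrow> \<forall>i\<in>{1..n}. A \<omega> i i = 0"
    and sym: "\<And>\<omega>. \<omega> \<in> space M \<Longrightarrow> \<forall>i\<in>{1..n}. \<forall>j\<in>{1..n}. A \<omega> i j = A \<omega> j i"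
    using pdsm by (auto simp: PDSM_def)
  have \<zeta>E: "\<zeta> \<in> {1..n} \<rightarrow>\<^sub>E {0, 1}" using \<zeta> by (simp add: Theta_def)
  define I where "I = {(i, j). 1 \<le> i \<and> i < j \<and> j \<le> n}"
  define X where "X = (\<lambda>(i, j) \<omega>. A \<omega> i j)"
  define m where "m = (\<lambda>(i, j). if \<zeta> i = 1 \<and> \<zeta> j = 1 then \<mu>\<^sub>1 else \<mu>\<^sub>2)"
  have indep: "indep_vars (\<lambda>_. borel) X I"
    using pdsm by (simp add: PDSM_def X_def I_def)
  have normal: "distributed M lborel (X e) (normal_density (m e) \<tau>)" if "e \<in> I" for e
    using pdsm that \<tau> by (auto simp: PDSM_def X_def I_def m_def)
  obtain H where H: "H \<subseteq> C" "card H = h"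
    using h(2) by (meson obtain_subset_with_card_n less_imp_le)
  define D where "D = C - H"
  define J where "J = {1..n} - C"
  have "finite C" by (simp add: C_def)
  then have fin: "finite C" "finite H" "finite D" "finite J"
    using finite_subset[OF H(1)] by (auto simp: D_def J_def)
  have cD: "card D = card C - h" using H fin by (simp add: D_def card_Diff_subset)
  have "C \<subseteq> {1..n}" by (auto simp: C_def)
  then have cJ: "real (card J) = real n - real (card C)"
    using card_mono[OF _ \<open>C \<subseteq> {1..n}\<close>] fin by (simp add: J_def card_Diff_subset of_nat_diff)
  have cHi: "card (H - {i}) = h - 1" if "i \<in> H" for i using that H fin by simp
  define Z where "Z = (\<lambda>s i S. zscore s m \<tau> X (star i S))"
  have sumX: "(\<Sum>e\<in>star i S. X e \<omega>) = (\<Sum>k\<in>S. A \<omega> i k)"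
    if "\<omega> \<in> space M" "i \<in> {1..n}" "S \<subseteq> {1..n}" for \<omega> i S
  proof -
    have "X (min i k, max i k) \<omega> = A \<omega> i k" if "k \<in> S" for k
      using sym[OF \<open>\<omega> \<in> space M\<close>] \<open>i \<in> {1..n}\<close> \<open>S \<subseteq> {1..n}\<close> that
      by (auto simp: X_def min_def max_def)
    then show ?thesis by (simp add: sum_star)
  qed
  have summ: "(\<Sum>e\<in>star i S. m e) = real (card S) * (if i \<in> C then \<mu>\<^sub>1 else \<mu>\<^sub>2)"
    if "i \<in> {1..n}" "S \<subseteq> C" for i S
  proof -
    have "m (min i k, max i k) = (if i \<in> C then \<mu>\<^sub>1 else \<mu>\<^sub>2)" if "k \<in> S" for k
      using \<open>i \<in> {1..n}\<close> \<open>S \<subseteq> C\<close> that by (auto simp: m_def C_def min_def max_def)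
    then show ?thesis by (simp add: sum_star)
  qed
  have Zeq: "(\<Sum>k\<in>S. A \<omega> i k) = real (card S) * (if i \<in> C then \<mu>\<^sub>1 else \<mu>\<^sub>2)
      + s * (\<tau> * sqrt (real (card S))) * Z s i S \<omega>"
    if "\<omega> \<in> space M" "i \<in> {1..n}" "S \<subseteq> C" "S \<noteq> {}" "s \<in> {1, -1}" for \<omega> i S s
  proof -
    have "S \<subseteq> {1..n}" "0 < card S"
      using that \<open>C \<subseteq> {1..n}\<close> fin finite_subset by (auto simp: card_gt_0_iff)
    then show ?thesis using that \<tau>
      by (auto simp: Z_def zscore_def sumX summ card_star field_simps)
  qed
  have Zdist: "distributed M lborel (Z s i S) std_normal_density"
    if "i \<in> {1..n}" "S \<subseteq> C - {i}" "S \<noteq> {}" "\<bar>s\<bar> = 1" for s i S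
    unfolding Z_def
  proof (rule distributed_zscore[OF indep normal \<tau> that(4)])
    show "star i S \<subseteq> I" unfolding I_def
      using that \<open>C \<subseteq> {1..n}\<close> by (intro star_subset_pairs) auto
    show "finite (star i S)" "star i S \<noteq> {}"
      using that fin(1) finite_subset[of S C] by (auto simp: star_def)
  qed
  define EJ where "EJ = {\<omega> \<in> space M. \<forall>j\<in>J. Z 1 j D \<omega> \<le> t}"
  define EH where "EH = {\<omega> \<in> space M. \<forall>i\<in>H. Z (-1) i D \<omega> \<le> t}"
  \<comment> \<open>sign \<open>1\<close>: \<open>i\<close> sends too much into \<open>H - {i}\<close>; sign \<open>-1\<close>: \<open>j\<close> sends too little\<close>
  define R where "R = (\<lambda>s i j. {\<omega> \<in> space M. u < Z s (if s = 1 then i else j) (H - {i}) \<omega>})"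
  define B where "B = (\<Union>(s, i, j)\<in>{1, -1} \<times> H \<times> J. R s i j)"
  have "D \<noteq> {}" using cD h by auto
  have Dstar: "star i D \<subseteq> I \<and> finite (star i D) \<and> star i D \<noteq> {}" if "i \<in> J \<union> H" for i
  proof -
    have "i \<in> {1..n}" "D \<subseteq> {1..n} - {i}"
      using that H \<open>C \<subseteq> {1..n}\<close> by (auto simp: D_def J_def)
    then show ?thesis
      using star_subset_pairs[of i n D] \<open>D \<noteq> {}\<close> fin(3) by (simp add: I_def star_def)
  qed
  have EJ: "prob EJ \<le> exp (- ((real n - real (card C)) * std_normal_density (t + 1)))"
    unfolding EJ_def Z_def cJ[symmetric]
    by (rule prob_all_zscores_le[OF indep normal \<tau> _ _ disjoint_family_star fin(4) t])
      (use Dstar in \<open>auto simp: J_def D_def\<close>)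
  have EH: "prob EH \<le> exp (- (real h * std_normal_density (t + 1)))"
    unfolding EH_def Z_def H(2)[symmetric]
    by (rule prob_all_zscores_le[OF indep normal \<tau> _ _ disjoint_family_star fin(2) t])
      (use Dstar in \<open>auto simp: D_def\<close>)
  have sub: "H - {i} \<subseteq> C" "H - {i} \<noteq> {}" if "i \<in> H" for i
  proof -
    show "H - {i} \<subseteq> C" using H by auto
    have "card (H - {i}) \<noteq> 0" using cHi[OF that] h by simp
    then show "H - {i} \<noteq> {}" by (metis card.empty)
  qed
  have Rdist: "distributed M lborel (Z s (if s = 1 then i else j) (H - {i})) std_normal_density"
    if "s \<in> {1, -1}" "i \<in> H" "j \<in> J" for s i j
    using that H sub[OF that(2)] \<open>C \<subseteq> {1..n}\<close> by (intro Zdist) (auto simp: J_def)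
  have Rmeas: "R s i j \<in> events" if "s \<in> {1, -1}" "i \<in> H" "j \<in> J" for s i j
  proof -
    have [measurable]: "Z s (if s = 1 then i else j) (H - {i}) \<in> borel_measurable M"
      using Rdist[OF that] by (simp add: distributed_def)
    show ?thesis unfolding R_def by measurable
  qed
  have Zmeas: "Z s i D \<in> borel_measurable M" if "i \<in> J \<union> H" "s \<in> {1, -1}" for s i
  proof -
    have "distributed M lborel (Z s i D) std_normal_density"
      using that H \<open>C \<subseteq> {1..n}\<close> \<open>D \<noteq> {}\<close> by (intro Zdist) (auto simp: J_def D_def)
    then show ?thesis by (simp add: distributed_def)
  qed
  have meas: "EJ \<in> events" "EH \<in> events" "B \<in> events"
  proof -
    show "EJ \<in> events" unfolding EJ_def
      by (rule sets.sets_Collect_finite_All[OF _ fin(4)]) (use Zmeas in measurable)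
    show "EH \<in> events" unfolding EH_def
      by (rule sets.sets_Collect_finite_All[OF _ fin(2)]) (use Zmeas in measurable)
    show "B \<in> events" unfolding B_def
      by (rule sets.finite_UN) (use fin Rmeas in auto)
  qed
  have B: "prob B \<le> 2 * (real n)\<^sup>2 * exp (- u\<^sup>2 / 2)"
  proof -
    have "prob B \<le> (\<Sum>(s, i, j)\<in>{1, -1} \<times> H \<times> J. prob (R s i j))"
      unfolding B_def case_prod_unfold
      by (rule finite_measure_subadditive_finite) (use fin Rmeas in auto)
    also have "\<dots> \<le> (\<Sum>(s, i, j)\<in>{1, -1 :: real} \<times> H \<times> J. exp (- u\<^sup>2 / 2))"
      by (rule sum_mono) (use std_normal_tail_upper[OF Rdist u] in \<open>auto simp: R_def\<close>)
    also have "\<dots> = 2 * (real h * real (card J)) * exp (- u\<^sup>2 / 2)"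
      by (simp add: card_cartesian_product H(2) case_prod_unfold)
    also have "\<dots> \<le> 2 * (real n)\<^sup>2 * exp (- u\<^sup>2 / 2)"
    proof -
      have "real h \<le> real n" "real (card J) \<le> real n"
        using card_mono[OF _ \<open>C \<subseteq> {1..n}\<close>] h cJ by auto
      then have "real h * real (card J) \<le> real n * real n" by (intro mult_mono) auto
      then show ?thesis by (simp add: power2_eq_square)
    qed
    finally show ?thesis .
  qed
  have "{\<omega> \<in> space M. \<zeta>' \<omega> = \<zeta>} \<subseteq> EJ \<union> EH \<union> B"
  proof (rule subsetI, rule ccontr)
    fix \<omega> assume "\<omega> \<in> {\<omega> \<in> space M. \<zeta>' \<omega> = \<zeta>}" and nb: "\<omega> \<notin> EJ \<union> EH \<union> B"
    then have \<omega>: "\<omega> \<in> space M" and eq: "\<zeta>' \<omega> = \<zeta>" by auto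
    from nb \<omega> obtain i j where j: "j \<in> J" "t < Z 1 j D \<omega>" and i: "i \<in> H" "t < Z (-1) i D \<omega>"
      unfolding EJ_def EH_def by force
    have "\<omega> \<notin> R 1 i j" "\<omega> \<notin> R (-1) i j" using nb i j unfolding B_def by force+
    then have r: "Z 1 i (H - {i}) \<omega> \<le> u" "Z (-1) j (H - {i}) \<omega> \<le> u"
      using \<omega> by (auto simp: R_def)
    have ij: "i \<in> {1..n}" "\<zeta> i = 1" "i \<in> C" "j \<in> {1..n}" "\<zeta> j \<noteq> 1" "j \<notin> C"
      using i j H by (auto simp: C_def J_def)
    have D: "D \<subseteq> C" by (auto simp: D_def)
    have split: "C - {i} = D \<union> (H - {i})" "D \<inter> (H - {i}) = {}"
      using H i by (auto simp: D_def)
    have sumC: "(\<Sum>k\<in>C - {i}. f k) = (\<Sum>k\<in>D. f k) + (\<Sum>k\<in>H - {i}. f k)" for f :: "nat \<Rightarrow> real"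
      unfolding split(1) by (rule sum.union_disjoint) (use fin split in auto)
    define rD rH where "rD = \<tau> * sqrt (real (card C) - real h)" and "rH = \<tau> * sqrt (real h - 1)"
    have pos: "0 < rD" "0 < rH" using h \<tau> by (auto simp: rD_def rH_def)
    have rr: "\<tau> * sqrt (real (card D)) = rD" "\<tau> * sqrt (real (card (H - {i}))) = rH"
      using cD cHi[OF i(1)] h by (auto simp: rD_def rH_def of_nat_diff)
    have gain: "(\<Sum>k\<in>C - {i}. A \<omega> j k) - (\<Sum>k\<in>C - {i}. A \<omega> i k)
       = (real (card D) + real (card (H - {i}))) * (\<mu>\<^sub>2 - \<mu>\<^sub>1)
         + rD * (Z 1 j D \<omega> + Z (-1) i D \<omega>) - rH * (Z (-1) j (H - {i}) \<omega> + Z 1 i (H - {i}) \<omega>)"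
      using Zeq[OF \<omega> ij(4) D \<open>D \<noteq> {}\<close>, of 1] Zeq[OF \<omega> ij(1) D \<open>D \<noteq> {}\<close>, of "-1"]
        Zeq[OF \<omega> ij(4) sub[OF i(1)], of "-1"] Zeq[OF \<omega> ij(1) sub[OF i(1)], of 1] ij
      by (simp add: sumC rr algebra_simps)
    have "real (card D) + real (card (H - {i})) = real (card C) - 1"
      using cD cHi[OF i(1)] h by (simp add: of_nat_diff)
    moreover have "rD * (t + t) < rD * (Z 1 j D \<omega> + Z (-1) i D \<omega>)"
      using pos i j by (intro mult_strict_left_mono) auto
    moreover have "rH * (Z (-1) j (H - {i}) \<omega> + Z 1 i (H - {i}) \<omega>) \<le> rH * (u + u)"
      using pos r by (intro mult_left_mono) auto
    moreover have "(real (card C) - 1) * (\<mu>\<^sub>2 - \<mu>\<^sub>1) + rD * (t + t) - rH * (u + u) \<ge> 0"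
      using margin by (simp add: rD_def rH_def algebra_simps)
    ultimately have "0 < (\<Sum>k\<in>C - {i}. A \<omega> j k) - (\<Sum>k\<in>C - {i}. A \<omega> i k)"
      unfolding gain by simp
    then have "g n (A \<omega>) \<zeta> < g n (A \<omega>) (\<zeta>(i := 0, j := 1))"
      using swap_gain[OF \<zeta>E ij(1,2,4,5) diag[OF \<omega>] sym[OF \<omega>]] by (simp add: C_def)
    moreover have "is_arg_max (g n (A \<omega>)) (\<lambda>\<zeta>. \<zeta> \<in> Theta \<gamma> n) \<zeta>"
      using mle \<omega> eq by (auto simp: is_MLE_def)
    ultimately show False
      using swap_in_Theta[OF \<zeta> ij(1,2,4,5)] by (auto simp: is_arg_max_def)
  qed
  then have "prob {\<omega> \<in> space M. \<zeta>' \<omega> = \<zeta>} \<le> prob (EJ \<union> EH \<union> B)"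
    using meas by (intro finite_measure_mono) auto
  also have "\<dots> \<le> prob EJ + prob EH + prob B"
    using measure_Un_le[of "EJ \<union> EH" M B] measure_Un_le[of EJ M EH] meas
    by auto
  finally show ?thesis using EJ EH B by simp
qed

text \<open>
  The finite bound is applied with \<open>h = \<lfloor>\<eta> n\<rfloor>\<close>, \<open>t = a sqrt (2 ln n)\<close> and
  \<open>u = sqrt (6 ln n)\<close>. The constant \<open>6\<close> makes the tail \<open>exp (- u\<^sup>2 / 2) = n\<^sup>-\<^sup>3\<close>, small
  enough for the union over \<open>2 n\<^sup>2\<close> events.
\<close>

lemma eventually_prob_exact_recovery_le:
  fixes \<gamma> \<alpha> \<beta> \<tau> :: real
    and M :: "nat \<Rightarrow> 'a measure"
  assumes \<gamma>: "0 < \<gamma>" "\<gamma> < 1" and \<alpha>\<beta>: "\<beta> < \<alpha>" and \<tau>: "0 < \<tau>"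
    and pdsm: "\<And>n. n \<in> sizes \<gamma> \<Longrightarrow>
           PDSM \<gamma> n (\<alpha> * sqrt (ln (real n) / real n)) (\<beta> * sqrt (ln (real n) / real n)) (\<tau>\<^sup>2)
             (\<zeta>star n) (M n) (A n)"
    and mle: "\<And>n. n \<in> sizes \<gamma> \<Longrightarrow> is_MLE \<gamma> n (M n) (A n) (\<zeta>MLE n)"
    and snr: "\<gamma> * SNR \<alpha> \<beta> \<tau> < 1"
  obtains b where "b \<longlonglongrightarrow> 0"
    "\<forall>\<^sub>F n in sequentially. n \<in> sizes \<gamma> \<longrightarrow>
       measure (M n) {\<omega> \<in> space (M n). \<zeta>MLE n \<omega> = \<zeta>star n} \<le> b n"
proof -
  obtain a \<eta> where a: "0 < a" "a < 1" and \<eta>: "0 < \<eta>" "\<eta> < \<gamma>"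
    and marg: "\<gamma> * (\<alpha> - \<beta>) \<le> 2 * \<tau> * (a * sqrt 2 * sqrt (\<gamma> - \<eta>)) - 2 * \<tau> * (sqrt 6 * sqrt \<eta>)"
    using margin_choice[OF \<gamma>, of "\<alpha> - \<beta>" \<tau>] \<alpha>\<beta> \<tau> snr by (auto simp: SNR_def)
  define t where "t = (\<lambda>n. a * sqrt (2 * ln (real n)))"
  define b where "b = (\<lambda>n. exp (- ((1 - \<gamma>) * real n * std_normal_density (t n + 1)))
      + exp (- (\<eta> / 2 * real n * std_normal_density (t n + 1))) + 2 / real n)"
  have "b \<longlonglongrightarrow> 0 + 0 + 0"
    unfolding b_def t_def using \<gamma> \<eta> a
    by (intro tendsto_add many_tails_limit lim_const_over_n) auto
  moreover have "\<forall>\<^sub>F n in sequentially. n \<in> sizes \<gamma> \<longrightarrow>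
       measure (M n) {\<omega> \<in> space (M n). \<zeta>MLE n \<omega> = \<zeta>star n} \<le> b n"
    \<comment> \<open>\<open>\<eta> n \<ge> 3\<close> gives \<open>h \<ge> 2\<close> and \<open>h \<ge> \<eta> n / 2\<close>\<close>
    using eventually_ge_at_top[of "nat \<lceil>3 / \<eta>\<rceil>"]
  proof (eventually_elim, intro impI)
    fix n assume n3: "nat \<lceil>3 / \<eta>\<rceil> \<le> n" and n: "n \<in> sizes \<gamma>"
    define C where "C = {k\<in>{1..n}. \<zeta>star n k = 1}"
    define h where "h = nat \<lfloor>\<eta> * real n\<rfloor>"
    define q where "q = sqrt (ln (real n) / real n)"
    have "3 / \<eta> \<le> real n" using n3 by linarith
    then have \<eta>n: "3 \<le> \<eta> * real n" using \<eta> by (simp add: field_simps)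
    have npos: "1 \<le> real n" using n by (auto simp: sizes_def)
    have ln0: "0 \<le> ln (real n)" using npos by simp
    have "\<zeta>star n \<in> Theta \<gamma> n" using pdsm[OF n] by (simp add: PDSM_def)
    then have cC: "real (card C) = \<gamma> * real n" unfolding C_def by (rule card_support_Theta)
    have h_le: "real h \<le> \<eta> * real n" and h_gt: "\<eta> * real n < real h + 1"
      using \<eta>n by (auto simp: h_def)
    have h2: "2 \<le> h" using h_gt \<eta>n by linarith
    have "\<eta> * real n < \<gamma> * real n" using \<eta> npos by (intro mult_strict_right_mono) auto
    then have hC: "h < card C" using h_le cC by linarith
    have qn: "q * real n = sqrt (ln (real n)) * sqrt (real n)"
      using npos by (simp add: q_def real_sqrt_divide real_div_sqrt field_simps)
    have q0: "0 \<le> q" using ln0 by (simp add: q_def)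
    \<comment> \<open>the inequality for \<open>a\<close> and \<open>\<eta>\<close>, multiplied by \<open>sqrt (n ln n)\<close>\<close>
    have "(real (card C) - 1) * (\<alpha> * q - \<beta> * q) \<le> (\<gamma> * real n) * (\<alpha> * q - \<beta> * q)"
      using cC \<alpha>\<beta> q0 by (intro mult_right_mono) (auto simp: mult_right_mono)
    also have "\<dots> = \<gamma> * (\<alpha> - \<beta>) * (sqrt (ln (real n)) * sqrt (real n))"
      unfolding qn[symmetric] by (simp add: algebra_simps)
    also have "\<dots> \<le> (2 * \<tau> * (a * sqrt 2 * sqrt (\<gamma> - \<eta>)) - 2 * \<tau> * (sqrt 6 * sqrt \<eta>))
        * (sqrt (ln (real n)) * sqrt (real n))"
      using ln0 by (intro mult_right_mono[OF marg]) auto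
    also have "\<dots> = 2 * \<tau> * (t n * sqrt (\<gamma> * real n - \<eta> * real n))
        - 2 * \<tau> * (sqrt (6 * ln (real n)) * sqrt (\<eta> * real n))"
    proof -
      have "sqrt (\<gamma> * real n - \<eta> * real n) = sqrt (\<gamma> - \<eta>) * sqrt (real n)"
        by (simp add: real_sqrt_mult[symmetric] left_diff_distrib)
      then show ?thesis by (simp add: t_def real_sqrt_mult algebra_simps)
    qed
    also have "\<dots> \<le> 2 * \<tau> * (t n * sqrt (real (card C) - real h))
        - 2 * \<tau> * (sqrt (6 * ln (real n)) * sqrt (real h - 1))"
      using \<tau> a ln0 h_le cC
      by (intro diff_mono mult_left_mono real_sqrt_le_mono) (auto simp: t_def)
    finally have margin: "(real (card C) - 1) * (\<alpha> * q - \<beta> * q)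
        \<le> 2 * \<tau> * (t n * sqrt (real (card C) - real h))
          - 2 * \<tau> * (sqrt (6 * ln (real n)) * sqrt (real h - 1))" .
    have "measure (M n) {\<omega> \<in> space (M n). \<zeta>MLE n \<omega> = \<zeta>star n}
      \<le> exp (- ((real n - real (card C)) * std_normal_density (t n + 1)))
        + exp (- (real h * std_normal_density (t n + 1)))
        + 2 * (real n)\<^sup>2 * exp (- (sqrt (6 * ln (real n)))\<^sup>2 / 2)"
      using prob_exact_recovery_le[OF pdsm[OF n] mle[OF n] \<tau>, folded C_def q_def, OF h2 hC _ _ margin]
        a ln0 by (simp add: t_def)
    also have "2 * (real n)\<^sup>2 * exp (- (sqrt (6 * ln (real n)))\<^sup>2 / 2) = 2 / real n"
    proof -
      have "exp (- (sqrt (6 * ln (real n)))\<^sup>2 / 2) = 1 / exp (ln (real n)) ^ 3"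
        using ln0 by (simp add: exp_minus exp_of_nat_mult[symmetric] field_simps)
      then show ?thesis using npos by (simp add: power2_eq_square power3_eq_cube)
    qed
    also have "exp (- ((real n - real (card C)) * std_normal_density (t n + 1)))
        = exp (- ((1 - \<gamma>) * real n * std_normal_density (t n + 1)))"
      by (simp add: cC left_diff_distrib)
    also have "exp (- (real h * std_normal_density (t n + 1)))
        \<le> exp (- (\<eta> / 2 * real n * std_normal_density (t n + 1)))"
    proof -
      have "\<eta> / 2 * real n \<le> real h" using h_gt \<eta>n by linarith
      then have "\<eta> / 2 * real n * std_normal_density (t n + 1) \<le> real h * std_normal_density (t n + 1)"
        by (rule mult_right_mono) simp
      then show ?thesis by simp
    qed
    finally show "measure (M n) {\<omega> \<in> space (M n). \<zeta>MLE n \<omega> = \<zeta>star n} \<le> b n"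
      by (simp add: b_def)
  qed
  ultimately show ?thesis using that[of b] by simp
qed

lemma sizes_at_top_nontrivial:
  assumes "infinite (sizes \<gamma>)"
  shows "sizes_at_top \<gamma> \<noteq> bot"
proof
  assume "sizes_at_top \<gamma> = bot"
  then have "\<forall>\<^sub>F n in sequentially. n \<notin> sizes \<gamma>"
    by (auto simp: sizes_at_top_def trivial_limit_def eventually_inf_principal)
  then have "finite (sizes \<gamma>)"
    by (auto simp: eventually_sequentially finite_nat_set_iff_bounded not_le[symmetric])
  with assms show False by simp
qed

section \<open>Failure of exact recovery\<close>

theorem theorem16:
  fixes \<gamma> \<alpha> \<beta> \<tau> :: real
    and M :: "nat \<Rightarrow> 'a measure"
    and A :: "nat \<Rightarrow> 'a \<Rightarrow> nat \<Rightarrow> nat \<Rightarrow> real"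
    and \<zeta>star :: "nat \<Rightarrow> nat \<Rightarrow> nat"
    and \<zeta>MLE :: "nat \<Rightarrow> 'a \<Rightarrow> nat \<Rightarrow> nat"
  assumes "0 < \<gamma>" and "\<gamma> < 1"
    and "infinite (sizes \<gamma>)"
    and "\<beta> < \<alpha>" and "0 < \<tau>"
    and "\<And>n. n \<in> sizes \<gamma> \<Longrightarrow>
           PDSM \<gamma> n (\<alpha> * sqrt (ln (real n) / real n)) (\<beta> * sqrt (ln (real n) / real n)) (\<tau>\<^sup>2)
             (\<zeta>star n) (M n) (A n)"
    and "\<And>n. n \<in> sizes \<gamma> \<Longrightarrow> is_MLE \<gamma> n (M n) (A n) (\<zeta>MLE n)"
    and "\<gamma> * SNR \<alpha> \<beta> \<tau> < 3 / 4"
  shows "Limsup (sizes_at_top \<gamma>)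
           (\<lambda>n. ereal (measure (M n) {\<omega> \<in> space (M n). agreement n (\<zeta>MLE n \<omega>) (\<zeta>star n) = 1})) = 0
       \<and> Liminf (sizes_at_top \<gamma>)
           (\<lambda>n. ereal (measure (M n) {\<omega> \<in> space (M n). agreement n (\<zeta>MLE n \<omega>) (\<zeta>star n) \<noteq> 1})) = 1"
proof -
  let ?R = "\<lambda>n. measure (M n) {\<omega> \<in> space (M n). agreement n (\<zeta>MLE n \<omega>) (\<zeta>star n) = 1}"
  let ?F = "\<lambda>n. measure (M n) {\<omega> \<in> space (M n). agreement n (\<zeta>MLE n \<omega>) (\<zeta>star n) \<noteq> 1}"
  have R: "?R n = measure (M n) {\<omega> \<in> space (M n). \<zeta>MLE n \<omega> = \<zeta>star n}"
    and F: "?F n = 1 - ?R n" if n: "n \<in> sizes \<gamma>" for n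
  proof -
    interpret prob_space "M n" using assms(6)[OF n] by (simp add: PDSM_def)
    have meas: "\<zeta>MLE n \<in> measurable (M n) (count_space (Theta \<gamma> n))"
      using assms(7)[OF n] by (simp add: is_MLE_def)
    have star: "\<zeta>star n \<in> Theta \<gamma> n" using assms(6)[OF n] by (simp add: PDSM_def)
    have set: "{\<omega> \<in> space (M n). agreement n (\<zeta>MLE n \<omega>) (\<zeta>star n) = 1}
        = {\<omega> \<in> space (M n). \<zeta>MLE n \<omega> = \<zeta>star n}"
      using agreement_eq_1_iff[OF _ _ star] n measurable_space[OF meas] by (auto simp: sizes_def)
    show "?R n = measure (M n) {\<omega> \<in> space (M n). \<zeta>MLE n \<omega> = \<zeta>star n}"
      by (simp only: set)
    have "{\<omega> \<in> space (M n). \<zeta>MLE n \<omega> = \<zeta>star n} = \<zeta>MLE n -` {\<zeta>star n} \<inter> space (M n)" by auto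
    also have "\<dots> \<in> events" using measurable_sets[OF meas, of "{\<zeta>star n}"] star by simp
    finally have ev: "{\<omega> \<in> space (M n). agreement n (\<zeta>MLE n \<omega>) (\<zeta>star n) = 1} \<in> events"
      by (simp only: set)
    have "{\<omega> \<in> space (M n). agreement n (\<zeta>MLE n \<omega>) (\<zeta>star n) \<noteq> 1}
        = space (M n) - {\<omega> \<in> space (M n). agreement n (\<zeta>MLE n \<omega>) (\<zeta>star n) = 1}" by auto
    then show "?F n = 1 - ?R n" using prob_compl[OF ev] by simp
  qed
  have snr: "\<gamma> * SNR \<alpha> \<beta> \<tau> < 1" using assms(8) by simp
  obtain b where b: "b \<longlonglongrightarrow> 0" and le: "\<forall>\<^sub>F n in sequentially. n \<in> sizes \<gamma> \<longrightarrow>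
       measure (M n) {\<omega> \<in> space (M n). \<zeta>MLE n \<omega> = \<zeta>star n} \<le> b n"
    using eventually_prob_exact_recovery_le[OF assms(1,2,4,5,6,7) snr] by blast
  have sz: "\<forall>\<^sub>F n in sizes_at_top \<gamma>. n \<in> sizes \<gamma>"
    by (simp add: sizes_at_top_def eventually_inf_principal)
  have nontriv: "\<not> trivial_limit (sizes_at_top \<gamma>)"
    using sizes_at_top_nontrivial[OF assms(3)] by simp
  have R0: "(?R \<longlongrightarrow> 0) (sizes_at_top \<gamma>)"
  proof (rule tendsto_sandwich[OF _ _ tendsto_const])
    show "(b \<longlongrightarrow> 0) (sizes_at_top \<gamma>)"
      by (rule filterlim_mono[OF b order_refl]) (simp add: sizes_at_top_def)
    show "\<forall>\<^sub>F n in sizes_at_top \<gamma>. ?R n \<le> b n"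
      using le unfolding sizes_at_top_def eventually_inf_principal by eventually_elim (simp add: R)
  qed simp
  have F1: "(?F \<longlongrightarrow> 1) (sizes_at_top \<gamma>)"
  proof (rule Lim_transform_eventually)
    show "((\<lambda>n. 1 - ?R n) \<longlongrightarrow> 1) (sizes_at_top \<gamma>)"
      using tendsto_diff[OF tendsto_const R0, of 1] by simp
    show "\<forall>\<^sub>F n in sizes_at_top \<gamma>. 1 - ?R n = ?F n"
      using sz by eventually_elim (simp add: F)
  qed
  show ?thesis
    using lim_imp_Limsup[OF nontriv, of "\<lambda>n. ereal (?R n)" 0]
      lim_imp_Liminf[OF nontriv, of "\<lambda>n. ereal (?F n)" 1] R0 F1
    by (simp add: zero_ereal_def one_ereal_def)
qed

end
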